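(* Let $X$ and $Y$ be red–blue Hackenbush positions with normal-play values $x$ and $y$ such that $x+y=0$. Then $*:X+*:Y\equiv^- 0 \pmod{\mathcal D}$, i.e. for every dicot game $G$, $o^-( *:X+*:Y+G)=o^-(G)$.
   Context: Red–blue Hackenbush positions have all edges red or blue (Left cuts blue, Right cuts red); each has a normal-play value, a dyadic rational (Conway number). $*:X$ denotes the ordinal sum of $*$ and $X$: the Hackenbush position consisting of a single green edge on the ground whose top vertex supports $X$ (the top vertex serves as the ground for $X$); in general the ordinal sum is defined recursively by $G:H=\{G^L, G:H^L \mid G^R, G:H^R\}$. Under misère play the last player to move loses; $o^-(G)$ is the misère outcome class. A game is dicot if at every position either both players have a move or neither does; $\mathcal D$ is the universe of dicot games. $A\equiv^- B \pmod{\mathcal D}$ means $o^-(A+G)=o^-(B+G)$ for all $G\in\mathcal D$. *)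

theory Defs
  imports Complex_Main "HOL-Library.FSet"
begin

section \<open>Short partizan games\<close>

datatype game = Game (lefts: "game fset") (rights: "game fset")

datatype player = Left | Right

fun opponent :: "player \<Rightarrow> player" where
  "opponent Left = Right"
| "opponent Right = Left"

fun options :: "player \<Rightarrow> game \<Rightarrow> game fset" where
  "options Left G = lefts G"
| "options Right G = rights G"

lemma size_lefts [termination_simp]:
  assumes "H |\<in>| lefts G" shows "size H < size G"
proof -
  have "size H < (\<Sum>x\<in>fset (lefts G). Suc (size x))"
    using member_le_sum[of H "fset (lefts G)" "\<lambda>x. Suc (size x)"] assms by simp
  then show ?thesis by (cases G) simp
qed

lemma size_rights [termination_simp]:
  assumes "H |\<in>| rights G" shows "size H < size G"
proof -
  have "size H < (\<Sum>x\<in>fset (rights G). Suc (size x))"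
    using member_le_sum[of H "fset (rights G)" "\<lambda>x. Suc (size x)"] assms by simp
  then show ?thesis by (cases G) simp
qed

lemma size_option [termination_simp]: "H |\<in>| options p G \<Longrightarrow> size H < size G"
  by (cases p) (auto simp: size_lefts size_rights)

lemmas [fundef_cong] = fimage_cong

function game_sum :: "game \<Rightarrow> game \<Rightarrow> game" where
  "game_sum G H =
     Game ((\<lambda>G'. game_sum G' H) |`| lefts G |\<union>| (\<lambda>H'. game_sum G H') |`| lefts H)
          ((\<lambda>G'. game_sum G' H) |`| rights G |\<union>| (\<lambda>H'. game_sum G H') |`| rights H)"
  by pat_completeness auto
termination
  by (relation "Wellfounded.measure (\<lambda>(G, H). size G + size H)")
     (auto simp: size_lefts size_rights)

declare game_sum.simps [simp del]

instantiation game :: "{zero, plus}"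
begin

definition zero_game :: game where
  "0 = Game {||} {||}"

definition plus_game :: "game \<Rightarrow> game \<Rightarrow> game" where
  "G + H = game_sum G H"

instance ..

end

lemma plus_game_rec:
  fixes G H :: game
  shows "G + H = Game ((\<lambda>G'. G' + H) |`| lefts G |\<union>| (\<lambda>H'. G + H') |`| lefts H)
                      ((\<lambda>G'. G' + H) |`| rights G |\<union>| (\<lambda>H'. G + H') |`| rights H)"
  unfolding plus_game_def by (rule game_sum.simps)

lemma zero_plus_game: "0 + G = (G :: game)"
proof (induction "size G" arbitrary: G rule: less_induct)
  case less
  have "(\<lambda>G'. 0 + G') |`| lefts G = lefts G"
    using fimage_cong[OF refl, of "lefts G" "\<lambda>G'. 0 + G'" "\<lambda>G'. G'"]
    by (simp add: less size_lefts)
  moreover have "(\<lambda>G'. 0 + G') |`| rights G = rights G"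
    using fimage_cong[OF refl, of "rights G" "\<lambda>G'. 0 + G'" "\<lambda>G'. G'"]
    by (simp add: less size_rights)
  ultimately show ?case
    by (subst plus_game_rec) (simp add: zero_game_def)
qed

definition star :: game where
  "star = Game {|0|} {|0|}"

function ordinal_sum :: "game \<Rightarrow> game \<Rightarrow> game" where
  "ordinal_sum G H =
     Game (lefts G |\<union>| (\<lambda>H'. ordinal_sum G H') |`| lefts H)
          (rights G |\<union>| (\<lambda>H'. ordinal_sum G H') |`| rights H)"
  by pat_completeness auto
termination
  by (relation "Wellfounded.measure (\<lambda>(G, H). size H)") (auto simp: size_lefts size_rights)

declare ordinal_sum.simps [simp del]


section \<open>Outcomes and equivalences\<close>

text \<open>
  \<open>normal_win p G\<close> and \<open>misere_win p G\<close>: player \<open>p\<close> wins \<open>G\<close> moving first. A player who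
  cannot move loses under normal play and wins under misere play.
\<close>

function normal_win :: "player \<Rightarrow> game \<Rightarrow> bool" where
  "normal_win p G \<longleftrightarrow> fBex (options p G) (\<lambda>G'. \<not> normal_win (opponent p) G')"
  by pat_completeness auto
termination
  by (relation "Wellfounded.measure (\<lambda>(p, G). size G)") (auto simp: size_option)

function misere_win :: "player \<Rightarrow> game \<Rightarrow> bool" where
  "misere_win p G \<longleftrightarrow>
     options p G = {||} \<or> fBex (options p G) (\<lambda>G'. \<not> misere_win (opponent p) G')"
  by pat_completeness auto
termination
  by (relation "Wellfounded.measure (\<lambda>(p, G). size G)") (auto simp: size_option)

declare normal_win.simps [simp del] misere_win.simps [simp del]

datatype outcome = Left_wins | Right_wins | Next_wins | Previous_wins

definition outcome_of :: "(player \<Rightarrow> game \<Rightarrow> bool) \<Rightarrow> game \<Rightarrow> outcome" where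
  "outcome_of win G =
     (if win Left G then if win Right G then Next_wins else Left_wins
      else if win Right G then Right_wins else Previous_wins)"

definition normal_outcome :: "game \<Rightarrow> outcome" where
  "normal_outcome = outcome_of normal_win"

definition misere_outcome :: "game \<Rightarrow> outcome" where
  "misere_outcome = outcome_of misere_win"

definition normal_equiv :: "game \<Rightarrow> game \<Rightarrow> bool" where
  "normal_equiv A B \<longleftrightarrow> (\<forall>G. normal_outcome (A + G) = normal_outcome (B + G))"

definition misere_equiv_mod :: "game set \<Rightarrow> game \<Rightarrow> game \<Rightarrow> bool" where
  "misere_equiv_mod U A B \<longleftrightarrow> (\<forall>G\<in>U. misere_outcome (A + G) = misere_outcome (B + G))"

inductive dicot :: "game \<Rightarrow> bool" where
  "\<lbrakk>lefts G = {||} \<longleftrightarrow> rights G = {||};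
    \<And>G'. G' |\<in>| lefts G |\<union>| rights G \<Longrightarrow> dicot G'\<rbrakk> \<Longrightarrow> dicot G"

definition dicots :: "game set" where
  "dicots = {G. dicot G}"


section \<open>Dyadic rationals as normal-play values\<close>

function int_game :: "int \<Rightarrow> game" where
  "int_game n =
     (if n = 0 then 0
      else if n > 0 then Game {|int_game (n - 1)|} {||}
      else Game {||} {|int_game (n + 1)|})"
  by pat_completeness auto
termination
  by (relation "Wellfounded.measure (\<lambda>n. nat \<bar>n\<bar>)") auto

declare int_game.simps [simp del]

text \<open>
  \<open>dyadic_game m k\<close> is the canonical form of \<open>m / 2 ^ k\<close>. For odd \<open>m\<close> and \<open>k > 0\<close> this is
  \<open>{(m - 1) / 2 ^ k | (m + 1) / 2 ^ k}\<close>, whose two options are halved into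
  \<open>(m div 2) / 2 ^ (k - 1)\<close> and \<open>(m div 2 + 1) / 2 ^ (k - 1)\<close>.
\<close>

fun dyadic_game :: "int \<Rightarrow> nat \<Rightarrow> game" where
  "dyadic_game m 0 = int_game m"
| "dyadic_game m (Suc k) =
     (if even m then dyadic_game (m div 2) k
      else Game {|dyadic_game (m div 2) k|} {|dyadic_game (m div 2 + 1) k|})"

definition has_value :: "game \<Rightarrow> rat \<Rightarrow> bool" where
  "has_value G x \<longleftrightarrow> (\<exists>m k. x = of_int m / 2 ^ k \<and> normal_equiv G (dyadic_game m k))"


section \<open>Hackenbush\<close>

datatype colour = Blue | Red | Green

text \<open>
  A finite multigraph, loops allowed, with a single ground vertex (all points of the ground
  are identified). The order of the two endpoints of an edge is irrelevant.
\<close>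

record ('v, 'e) hackenbush =
  ground :: 'v
  edges :: "'e fset"
  ends :: "'e \<Rightarrow> 'v \<times> 'v"
  colour :: "'e \<Rightarrow> colour"

definition adjacent :: "('v, 'e) hackenbush \<Rightarrow> 'v \<Rightarrow> 'v \<Rightarrow> bool" where
  "adjacent X u v \<longleftrightarrow> (\<exists>e. e |\<in>| edges X \<and> (ends X e = (u, v) \<or> ends X e = (v, u)))"

text \<open>
  An edge of \<open>X\<close> makes its two endpoints adjacent, so testing reachability of one of them
  suffices. After each move the edges no longer connected to the ground are removed.
\<close>

definition supported :: "('v, 'e) hackenbush \<Rightarrow> 'e \<Rightarrow> bool" where
  "supported X e \<longleftrightarrow> (adjacent X)\<^sup>*\<^sup>* (ground X) (fst (ends X e))"

definition prune :: "('v, 'e) hackenbush \<Rightarrow> ('v, 'e) hackenbush" where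
  "prune X = X\<lparr>edges := ffilter (supported X) (edges X)\<rparr>"

definition cut_edge :: "('v, 'e) hackenbush \<Rightarrow> 'e \<Rightarrow> ('v, 'e) hackenbush" where
  "cut_edge X e = prune (X\<lparr>edges := edges X |-| {|e|}\<rparr>)"

definition position :: "('v, 'e) hackenbush \<Rightarrow> bool" where
  "position X \<longleftrightarrow> (\<forall>e. e |\<in>| edges X \<longrightarrow> supported X e)"

definition red_blue :: "('v, 'e) hackenbush \<Rightarrow> bool" where
  "red_blue X \<longleftrightarrow> (\<forall>e. e |\<in>| edges X \<longrightarrow> colour X e \<in> {Red, Blue})"

lemma fcard_cut:
  assumes "e |\<in>| edges X" shows "fcard (edges (cut_edge X e)) < fcard (edges X)"
proof -
  have "edges (cut_edge X e) |\<subset>| edges X"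
    using assms by (auto simp: cut_edge_def prune_def)
  then show ?thesis by (rule pfsubset_fcard_mono)
qed

function hackenbush_game :: "('v, 'e) hackenbush \<Rightarrow> game" where
  "hackenbush_game X =
     Game ((\<lambda>e. hackenbush_game (cut_edge X e)) |`|
             ffilter (\<lambda>e. colour X e \<in> {Blue, Green}) (edges X))
          ((\<lambda>e. hackenbush_game (cut_edge X e)) |`|
             ffilter (\<lambda>e. colour X e \<in> {Red, Green}) (edges X))"
  by pat_completeness auto
termination
  by (relation "Wellfounded.measure (\<lambda>X. fcard (edges X))") (auto simp: fcard_cut)

declare hackenbush_game.simps [simp del]

text \<open>
  \<open>sprig X\<close> puts \<open>X\<close> on top of a single green edge (\<open>None\<close>, as an edge) whose bottom is the
  new ground (\<open>None\<close>, as a vertex) and whose top is the old one.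
\<close>

definition sprig :: "('v, 'e) hackenbush \<Rightarrow> ('v option, 'e option) hackenbush" where
  "sprig X =
     \<lparr>ground = None,
      edges = finsert None (Some |`| edges X),
      ends = (\<lambda>e. case e of None \<Rightarrow> (None, Some (ground X))
                          | Some e' \<Rightarrow> map_prod Some Some (ends X e')),
      colour = (\<lambda>e. case e of None \<Rightarrow> Green | Some e' \<Rightarrow> colour X e')\<rparr>"

lemma adjacent_sprig_None:
  "adjacent (sprig X) None w \<longleftrightarrow> w = Some (ground X)"
  by (auto simp: adjacent_def sprig_def map_prod_def split: prod.splits option.splits)

lemma adjacent_sprig_Some:
  "adjacent (sprig X) (Some v) w \<longleftrightarrow>
     (case w of None \<Rightarrow> v = ground X | Some w' \<Rightarrow> adjacent X v w')"
  by (auto simp: adjacent_def sprig_def map_prod_def prod_eq_iff split: prod.splits option.splits)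

lemma reachable_sprig:
  "(adjacent (sprig X))\<^sup>*\<^sup>* None (Some v) \<longleftrightarrow> (adjacent X)\<^sup>*\<^sup>* (ground X) v"
proof
  have "case w of None \<Rightarrow> True | Some v \<Rightarrow> (adjacent X)\<^sup>*\<^sup>* (ground X) v"
    if "(adjacent (sprig X))\<^sup>*\<^sup>* None w" for w
    using that
  proof (induction rule: rtranclp_induct)
    case (step y z)
    then show ?case
      by (cases y; cases z)
         (auto simp: adjacent_sprig_None adjacent_sprig_Some intro: rtranclp.rtrancl_into_rtrancl)
  qed simp
  then show "(adjacent (sprig X))\<^sup>*\<^sup>* None (Some v) \<Longrightarrow> (adjacent X)\<^sup>*\<^sup>* (ground X) v"
    by fastforce
next
  show "(adjacent X)\<^sup>*\<^sup>* (ground X) v \<Longrightarrow> (adjacent (sprig X))\<^sup>*\<^sup>* None (Some v)"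
  proof (induction rule: rtranclp_induct)
    case base
    show ?case by (simp add: adjacent_sprig_None r_into_rtranclp)
  next
    case (step y z)
    then show ?case
      by (auto simp: adjacent_sprig_Some intro: rtranclp.rtrancl_into_rtrancl)
  qed
qed

lemma supported_sprig:
  "supported (sprig X) None" "supported (sprig X) (Some e) \<longleftrightarrow> supported X e"
proof -
  show "supported (sprig X) None" by (simp add: supported_def sprig_def)
  have "ground (sprig X) = None" "fst (ends (sprig X) (Some e)) = Some (fst (ends X e))"
    by (simp_all add: sprig_def)
  then show "supported (sprig X) (Some e) \<longleftrightarrow> supported X e"
    by (simp add: supported_def reachable_sprig)
qed

lemma prune_sprig: "prune (sprig X) = sprig (prune X)"
proof -
  have "ffilter (supported (sprig X)) (edges (sprig X))
      = finsert None (Some |`| ffilter (supported X) (edges X))"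
    by (auto simp: supported_sprig sprig_def[of X, THEN arg_cong[where f = edges]])
  then have "prune (sprig X) =
      (sprig X)\<lparr>edges := finsert None (Some |`| ffilter (supported X) (edges X))\<rparr>"
    by (simp add: prune_def)
  then show ?thesis
    by (simp add: sprig_def prune_def fun_eq_iff split: option.split)
qed

lemma cut_sprig_Some: "cut_edge (sprig X) (Some e) = sprig (cut_edge X e)"
proof -
  have "(sprig X)\<lparr>edges := edges (sprig X) |-| {|Some e|}\<rparr> = sprig (X\<lparr>edges := edges X |-| {|e|}\<rparr>)"
    by (auto simp: sprig_def)
  then show ?thesis by (simp add: cut_edge_def prune_sprig)
qed

lemma edges_cut_sprig_None: "edges (cut_edge (sprig X) None) = {||}"
proof -
  let ?Y = "(sprig X)\<lparr>edges := edges (sprig X) |-| {|None|}\<rparr>"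
  have no: "\<not> adjacent ?Y None w" for w
    by (auto simp: adjacent_def sprig_def prod_eq_iff)
  have "w = None" if "(adjacent ?Y)\<^sup>*\<^sup>* None w" for w
    using that by (induction rule: rtranclp_induct) (auto simp: no)
  then have "\<not> supported ?Y e" if "e |\<in>| edges ?Y" for e
    using that by (force simp: supported_def sprig_def)
  then show ?thesis by (auto simp: cut_edge_def prune_def)
qed

text \<open>The graph-theoretic and the recursive description of the sprig agree.\<close>

lemma hackenbush_game_sprig:
  "hackenbush_game (sprig X) = ordinal_sum star (hackenbush_game X)"
proof (induction "fcard (edges X)" arbitrary: X rule: less_induct)
  case less
  have none: "hackenbush_game (cut_edge (sprig X) None) = 0"
    by (subst hackenbush_game.simps)
       (simp add: edges_cut_sprig_None zero_game_def fset_eq_iff)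
  have some: "hackenbush_game (cut_edge (sprig X) (Some e)) = ordinal_sum star (hackenbush_game (cut_edge X e))"
    if "e |\<in>| edges X" for e
    using less[OF fcard_cut[OF that]] by (simp add: cut_sprig_Some)
  have filt: "ffilter (\<lambda>e. colour (sprig X) e \<in> {c, Green}) (edges (sprig X))
      = finsert None (Some |`| ffilter (\<lambda>e. colour X e \<in> {c, Green}) (edges X))" for c
    by (auto simp: sprig_def)
  have opts: "(\<lambda>e. hackenbush_game (cut_edge (sprig X) e)) |`|
        ffilter (\<lambda>e. colour (sprig X) e \<in> {c, Green}) (edges (sprig X))
      = {|0|} |\<union>| ordinal_sum star |`| ((\<lambda>e. hackenbush_game (cut_edge X e)) |`|
          ffilter (\<lambda>e. colour X e \<in> {c, Green}) (edges X))" for c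
    unfolding filt by (auto simp: none some fimage_fimage intro!: fimage_cong)
  have "hackenbush_game (sprig X) =
     Game ({|0|} |\<union>| ordinal_sum star |`| lefts (hackenbush_game X))
          ({|0|} |\<union>| ordinal_sum star |`| rights (hackenbush_game X))"
    by (subst hackenbush_game.simps) (simp only: opts hackenbush_game.simps[of X] game.sel)
  also have "\<dots> = ordinal_sum star (hackenbush_game X)"
    by (subst ordinal_sum.simps) (simp add: star_def)
  finally show ?case .
qed

end

theory Submission
  imports Defs
begin

text \<open>
  If a player survives moving second in the normal-play sum \<open>A + B\<close>, she can play
  \<open>(*:A + *:B) + G\<close> by following her misere strategy on \<open>G\<close>, answering moves in \<open>A\<close> or \<open>B\<close> by
  the normal-play strategy on \<open>A + B\<close>, and answering the deletion of one of the two stalks by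
  deleting the other. She is only stuck if it is her turn and \<open>G\<close> has run out (for both players,
  as \<open>G\<close> is dicot). Red--blue positions are never first-player wins, so she survives moving
  second in \<open>A\<close> or in \<open>B\<close>, say in \<open>B\<close>; she then deletes the stalk of \<open>A\<close> and wins \<open>*:B\<close>, in
  which whoever runs out of moves in \<open>B\<close> has to delete the stalk and loses.
\<close>

section \<open>Options of sums\<close>

lemma opponent_opponent [simp]: "opponent (opponent p) = p"
  by (cases p) auto

lemma options_plus:
  fixes G H :: game
  shows "options p (G + H) = (\<lambda>G'. G' + H) |`| options p G |\<union>| (\<lambda>H'. G + H') |`| options p H"
  by (cases p) (simp_all add: plus_game_rec[of G H])

lemma options_plus_leftI:
  fixes G H :: game
  shows "G' |\<in>| options p G \<Longrightarrow> G' + H |\<in>| options p (G + H)"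
  by (simp add: options_plus)

lemma options_plus_rightI:
  fixes G H :: game
  shows "H' |\<in>| options p H \<Longrightarrow> G + H' |\<in>| options p (G + H)"
  by (simp add: options_plus)

lemma options_plusE:
  fixes G H :: game
  assumes "K |\<in>| options p (G + H)"
  obtains G' where "G' |\<in>| options p G" "K = G' + H"
  | H' where "H' |\<in>| options p H" "K = G + H'"
  using assms by (auto simp: options_plus)

lemma options_zero [simp]: "options p 0 = {||}"
  by (cases p) (simp_all add: zero_game_def)

lemma options_ordinal_sum_star:
  "options p (ordinal_sum star H) = finsert 0 (ordinal_sum star |`| options p H)"
  by (cases p) (subst ordinal_sum.simps, simp add: star_def)+

lemma plus_game_commute: "G + H = H + (G :: game)"
proof (induction "size G + size H" arbitrary: G H rule: less_induct)
  case less
  have "(\<lambda>G'. G' + H) |`| options p G = (\<lambda>G'. H + G') |`| options p G"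
    "(\<lambda>H'. G + H') |`| options p H = (\<lambda>H'. H' + G) |`| options p H" for p
    by (auto intro!: fimage_cong less simp: size_option)
  from this[of Left] this[of Right] show ?case
    by (simp add: plus_game_rec[of G H] plus_game_rec[of H G] sup_commute)
qed

lemma plus_zero_game: "G + 0 = (G :: game)"
  by (metis plus_game_commute zero_plus_game)

section \<open>Normal play\<close>

text \<open>The hereditary form of not being a first-player win in normal play. It passes to
  options, so it persists as play in \<open>A\<close> and \<open>B\<close> proceeds.\<close>

inductive never_fuzzy :: "game \<Rightarrow> bool" where
  "\<lbrakk>\<not> (normal_win Left G \<and> normal_win Right G);
    \<And>p G'. G' |\<in>| options p G \<Longrightarrow> never_fuzzy G'\<rbrakk> \<Longrightarrow> never_fuzzy G"

lemma never_fuzzy_option: "never_fuzzy G \<Longrightarrow> G' |\<in>| options p G \<Longrightarrow> never_fuzzy G'"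
  by (auto elim: never_fuzzy.cases)

lemma never_fuzzy_normal_win: "never_fuzzy G \<Longrightarrow> normal_win p G \<Longrightarrow> \<not> normal_win (opponent p) G"
  by (cases p) (auto elim: never_fuzzy.cases)

lemma normal_winI: "G' |\<in>| options p G \<Longrightarrow> \<not> normal_win (opponent p) G' \<Longrightarrow> normal_win p G"
  by (subst normal_win.simps) auto

lemma normal_winE:
  assumes "normal_win p G"
  obtains G' where "G' |\<in>| options p G" "\<not> normal_win (opponent p) G'"
  using assms by (subst (asm) normal_win.simps) auto

text \<open>The second player answers every move in the summand where it was made, following the
  strategy there.\<close>

lemma not_normal_win_plus:
  assumes "\<not> normal_win p G" "\<not> normal_win p H"
  shows "\<not> normal_win p (G + H)"
  using assms
proof (induction "size G + size H" arbitrary: G H rule: less_induct)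
  case less
  show ?case
  proof
    assume "normal_win p (G + H)"
    then obtain K where K: "K |\<in>| options p (G + H)" "\<not> normal_win (opponent p) K"
      by (rule normal_winE)
    from K(1) show False
    proof (cases rule: options_plusE)
      case (1 G')
      then have "normal_win (opponent p) G'" using less.prems normal_winI by blast
      then obtain G'' where G'': "G'' |\<in>| options (opponent p) G'" "\<not> normal_win p G''"
        by (auto elim: normal_winE)
      then have "\<not> normal_win p (G'' + H)"
        using less 1 size_option[OF G''(1)] size_option[OF 1(1)] by auto
      then have "normal_win (opponent p) (G' + H)"
        using normal_winI[OF options_plus_leftI[OF G''(1)]] by simp
      then show False using K 1 by simp
    next
      case (2 H')
      then have "normal_win (opponent p) H'" using less.prems normal_winI by blast
      then obtain H'' where H'': "H'' |\<in>| options (opponent p) H'" "\<not> normal_win p H''"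
        by (auto elim: normal_winE)
      then have "\<not> normal_win p (G + H'')"
        using less 2 size_option[OF H''(1)] size_option[OF 2(1)] by auto
      then have "normal_win (opponent p) (G + H')"
        using normal_winI[OF options_plus_rightI[OF H''(1)]] by simp
      then show False using K 2 by simp
    qed
  qed
qed

text \<open>If \<open>p\<close> won both summands moving first, the opponent would lose
  \<open>A\<close> moving first. So \<open>p\<close> could open with a winning move to some
  \<open>B'\<close> and leave the opponent to move in a sum of two games each lost by the first
  mover.\<close>

lemma never_fuzzy_plus_cases:
  assumes "never_fuzzy A" "\<not> normal_win p (A + B)"
  shows "\<not> normal_win p A \<or> \<not> normal_win p B"
proof (rule ccontr)
  assume "\<not> ?thesis"
  then have A: "\<not> normal_win (opponent p) A" and "normal_win p B"
    using never_fuzzy_normal_win[OF assms(1), of p] by auto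
  then obtain B' where B': "B' |\<in>| options p B" "\<not> normal_win (opponent p) B'"
    by (auto elim: normal_winE)
  then have "normal_win p (A + B)"
    using normal_winI options_plus_rightI not_normal_win_plus A by blast
  then show False using assms by simp
qed

section \<open>Misere play of sprigs\<close>

lemma misere_winI: "G' |\<in>| options p G \<Longrightarrow> \<not> misere_win (opponent p) G' \<Longrightarrow> misere_win p G"
  by (subst misere_win.simps) auto

lemma misere_winE:
  assumes "misere_win p G"
  obtains "options p G = {||}"
  | G' where "G' |\<in>| options p G" "\<not> misere_win (opponent p) G'"
  using assms by (subst (asm) misere_win.simps) auto

lemma misere_win_zero [simp]: "misere_win p 0"
  by (subst misere_win.simps) simp

text \<open>Deleting the stalk leaves \<open>0\<close>, where the opponent is stuck and so wins.
  This losing move is always available, hence a player without moves in \<open>H\<close> loses, as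
  in normal play.\<close>

lemma misere_win_ordinal_sum_star: "misere_win p (ordinal_sum star H) \<longleftrightarrow> normal_win p H"
proof (induction "size H" arbitrary: p H rule: less_induct)
  case less
  then have "misere_win (opponent p) (ordinal_sum star H') \<longleftrightarrow> normal_win (opponent p) H'"
    if "H' |\<in>| options p H" for H'
    using that size_option by blast
  then show ?case
    by (subst misere_win.simps, subst normal_win.simps) (auto simp: options_ordinal_sum_star)
qed

lemma dicot_option: "dicot G \<Longrightarrow> G' |\<in>| options p G \<Longrightarrow> dicot G'"
  by (cases p) (auto elim: dicot.cases)

lemma dicot_stuck_eq_zero: "dicot G \<Longrightarrow> options p G = {||} \<Longrightarrow> G = 0"
  by (cases p; cases G) (auto elim: dicot.cases simp: zero_game_def)

lemma zero_option_sprig: "0 |\<in>| options p (ordinal_sum star H)"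
  by (simp add: options_ordinal_sum_star)

lemma sprig_option:
  "H' |\<in>| options p H \<Longrightarrow> ordinal_sum star H' |\<in>| options p (ordinal_sum star H)"
  by (simp add: options_ordinal_sum_star)

text \<open>The endgame after \<open>G\<close> has run out, with \<open>p\<close> to move:
  \<open>p\<close> deletes one stalk so that the remaining sprig is lost by the opponent moving
  first.\<close>

lemma misere_win_sprigs:
  assumes "never_fuzzy A" "\<not> normal_win (opponent p) (A + B)"
  shows "misere_win p (ordinal_sum star A + ordinal_sum star B)"
proof -
  consider "\<not> normal_win (opponent p) A" | "\<not> normal_win (opponent p) B"
    using never_fuzzy_plus_cases[OF assms] by blast
  then show ?thesis
  proof cases
    case 1
    then have "\<not> misere_win (opponent p) (ordinal_sum star A + 0)"
      by (simp add: misere_win_ordinal_sum_star plus_zero_game zero_plus_game)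
    then show ?thesis using misere_winI options_plus_rightI zero_option_sprig by blast
  next
    case 2
    then have "\<not> misere_win (opponent p) (0 + ordinal_sum star B)"
      by (simp add: misere_win_ordinal_sum_star zero_plus_game)
    then show ?thesis using misere_winI options_plus_leftI zero_option_sprig by blast
  qed
qed

text \<open>The claims for \<open>p\<close> moving first and second share one induction, since a
  move in \<open>G\<close> leads from one to the other. The condition on \<open>A + B\<close> always
  has the opponent to move, because moves there are made in pairs.\<close>

lemma sprigs_plus_dicot:
  assumes "dicot G" "never_fuzzy A" "never_fuzzy B" "\<not> normal_win (opponent p) (A + B)"
  shows "(misere_win p G \<longrightarrow> misere_win p (ordinal_sum star A + ordinal_sum star B + G)) \<and>
    (\<not> misere_win (opponent p) G \<longrightarrow>
      \<not> misere_win (opponent p) (ordinal_sum star A + ordinal_sum star B + G))"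
  using assms
proof (induction "size A + size B + size G" arbitrary: A B G rule: less_induct)
  case less
  let ?s = "ordinal_sum star" and ?q = "opponent p"
  note IH = less.hyps
  show ?case
  proof (intro conjI impI)
    assume "misere_win p G"
    then show "misere_win p (?s A + ?s B + G)"
    proof (cases rule: misere_winE)
      case 1
      then have "G = 0" using less.prems dicot_stuck_eq_zero by blast
      then show ?thesis
        using misere_win_sprigs[where A = A and B = B and p = p] less.prems
        by (simp add: plus_zero_game zero_plus_game)
    next
      case (2 G')
      then have "\<not> misere_win ?q (?s A + ?s B + G')"
        using IH[of A B G'] less.prems dicot_option size_option[OF 2(1)] by auto
      then show ?thesis using misere_winI options_plus_rightI 2 by blast
    qed
  next
    assume nq: "\<not> misere_win ?q G"
    have answer: "misere_win p K" if K: "K |\<in>| options ?q (?s A + ?s B + G)" for K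
      using K
    proof (cases rule: options_plusE)
      case (2 G')
      then have "misere_win p G'" using nq misere_winI[of G' ?q G] by auto
      then show ?thesis
        using IH[of A B G'] less.prems dicot_option size_option[OF 2(1)] 2 by auto
    next
      case (1 L)
      have win: "misere_win p (L + G)"
        if "L' |\<in>| options p L" "\<not> misere_win ?q (L' + G)" for L'
        using misere_winI options_plus_leftI that by blast
      \<comment> \<open>The opponent has just moved in \<open>A\<close> or in \<open>B\<close>;
        \<open>A1\<close> and \<open>B1\<close> cover both cases. The normal-play reply of
        \<open>p\<close> restores the condition of the induction.\<close>
      have reply: "misere_win p (?s A1 + ?s B1 + G)"
        if o: "A1 + B1 |\<in>| options ?q (A + B)" and nf: "never_fuzzy A1" "never_fuzzy B1"
          and sz: "size A1 + size B1 < size A + size B" for A1 B1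
      proof -
        have "normal_win p (A1 + B1)" using normal_winI[OF o] less.prems by auto
        then obtain M where M: "M |\<in>| options p (A1 + B1)" "\<not> normal_win ?q M"
          by (rule normal_winE)
        from M(1) show ?thesis
        proof (cases rule: options_plusE)
          case A2: (1 A2)
          then have "\<not> misere_win ?q (?s A2 + ?s B1 + G)"
            using IH[of A2 B1 G] less.prems nf never_fuzzy_option[OF nf(1)] M nq sz
              size_option[OF A2(1)] by auto
          moreover have "?s A2 + ?s B1 + G |\<in>| options p (?s A1 + ?s B1 + G)"
            using A2 by (intro options_plus_leftI sprig_option)
          ultimately show ?thesis by (blast intro: misere_winI)
        next
          case B2: (2 B2)
          then have "\<not> misere_win ?q (?s A1 + ?s B2 + G)"
            using IH[of A1 B2 G] less.prems nf never_fuzzy_option[OF nf(2)] M nq sz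
              size_option[OF B2(1)] by auto
          moreover have "?s A1 + ?s B2 + G |\<in>| options p (?s A1 + ?s B1 + G)"
            using B2 by (intro options_plus_leftI[of _ _ "?s A1 + ?s B1"] options_plus_rightI sprig_option)
          ultimately show ?thesis by (blast intro: misere_winI)
        qed
      qed
      \<comment> \<open>This is the position after both stalks are deleted, with the opponent to
        move.\<close>
      have G0: "\<not> misere_win ?q (0 + 0 + G)" using nq by (simp add: zero_plus_game)
      from 1(1) show ?thesis
      proof (cases rule: options_plusE)
        case a: (1 A')
        then consider "A' = 0" | A1 where "A1 |\<in>| options ?q A" "A' = ?s A1"
          by (auto simp: options_ordinal_sum_star)
        then show ?thesis
        proof cases
          case z: 1
          show ?thesis
            using win[of "0 + 0"] G0 options_plus_rightI[where G = 0, OF zero_option_sprig[of p B]] 1 a z by simp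
        next
          case 2
          then show ?thesis
            using reply[of A1 B] options_plus_leftI[OF 2(1)] never_fuzzy_option less.prems
              size_option[OF 2(1)] 1 a by auto
        qed
      next
        case b: (2 B')
        then consider "B' = 0" | B1 where "B1 |\<in>| options ?q B" "B' = ?s B1"
          by (auto simp: options_ordinal_sum_star)
        then show ?thesis
        proof cases
          case z: 1
          show ?thesis
            using win[of "0 + 0"] G0 options_plus_leftI[where H = 0, OF zero_option_sprig[of p A]] 1 b z by simp
        next
          case 2
          then show ?thesis
            using reply[of A B1] options_plus_rightI[OF 2(1)] never_fuzzy_option less.prems
              size_option[OF 2(1)] 1 b by auto
        qed
      qed
    qed
    \<comment> \<open>Being stuck would win in misere play; a stalk to delete rules that
      out.\<close>
    have "options ?q (?s A + ?s B + G) \<noteq> {||}"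
      using options_plus_leftI[OF options_plus_leftI[OF zero_option_sprig]] by blast
    then show "\<not> misere_win ?q (?s A + ?s B + G)"
      using answer by (auto elim: misere_winE)
  qed
qed

section \<open>Values\<close>

text \<open>Changing the sign of \<open>m\<close> negates the game, exchanging the roles of the
  players. The options are again of the form \<open>dyadic_game m' k'\<close>, so the symmetry can
  be iterated.\<close>

lemma dyadic_game_options_uminus:
  assumes "K |\<in>| options p (dyadic_game m k)"
  shows "\<exists>m' k'. K = dyadic_game m' k' \<and>
    dyadic_game (- m') k' |\<in>| options (opponent p) (dyadic_game (- m) k)"
  using assms
proof (induction m k rule: dyadic_game.induct)
  case (1 m)
  have "p = Left \<and> m > 0 \<and> K = int_game (m - 1) \<or> p = Right \<and> m < 0 \<and> K = int_game (m + 1)"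
    using 1 by (cases p) (simp_all add: int_game.simps[of m] zero_game_def split: if_splits)
  then show ?case
  proof (elim disjE conjE)
    assume "p = Left" "m > 0" "K = int_game (m - 1)"
    then show ?thesis
      by (intro exI[of _ "m - 1"] exI[of _ 0]) (simp add: int_game.simps[of "- m"])
  next
    assume "p = Right" "m < 0" "K = int_game (m + 1)"
    then show ?thesis
      by (intro exI[of _ "m + 1"] exI[of _ 0]) (simp add: int_game.simps[of "- m"])
  qed
next
  case (2 m k)
  show ?case
  proof (cases "even m")
    case True
    then have "- m div 2 = - (m div 2)" by (metis dvd_neg_div)
    then show ?thesis using 2 True by simp
  next
    case False
    \<comment> \<open>For odd \<open>m\<close>, the sign change swaps rounding down and rounding up
      of \<open>m / 2\<close>, and with it the Left and Right options.\<close>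
    then have m: "- m div 2 = - (m div 2 + 1)" "- m div 2 + 1 = - (m div 2)" by presburger+
    show ?thesis
    proof (cases p)
      case Left
      with "2.prems" False m show ?thesis
        by (intro exI[of _ "m div 2"] exI[of _ k]) simp
    next
      case Right
      with "2.prems" False m(1) show ?thesis
        by (intro exI[of _ "m div 2 + 1"] exI[of _ k]) (simp del: minus_add_distrib)
    qed
  qed
qed

text \<open>Mirror strategy: the second player copies each move, negated, in the other
  summand.\<close>

lemma not_normal_win_dyadic_game_uminus:
  "\<not> normal_win p (dyadic_game m k + dyadic_game (- m) k)"
proof (induction "size (dyadic_game m k)" arbitrary: p m k rule: less_induct)
  case less
  show ?case
  proof
    assume "normal_win p (dyadic_game m k + dyadic_game (- m) k)"
    then obtain K where K: "K |\<in>| options p (dyadic_game m k + dyadic_game (- m) k)"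
      "\<not> normal_win (opponent p) K" by (rule normal_winE)
    from K(1) show False
    proof (cases rule: options_plusE)
      case (1 G')
      from dyadic_game_options_uminus[OF 1(1)] obtain m' k' where
        *: "G' = dyadic_game m' k'"
        "dyadic_game (- m') k' |\<in>| options (opponent p) (dyadic_game (- m) k)" by blast
      then have "\<not> normal_win p (dyadic_game m' k' + dyadic_game (- m') k')"
        using less size_option[OF 1(1)] by simp
      then have "normal_win (opponent p) K"
        using normal_winI[OF options_plus_rightI[OF *(2)]] * 1 by simp
      then show False using K by simp
    next
      case (2 H')
      from dyadic_game_options_uminus[OF 2(1)] obtain m' k' where
        *: "H' = dyadic_game m' k'"
        "dyadic_game (- m') k' |\<in>| options (opponent p) (dyadic_game m k)" by auto
      then have "\<not> normal_win p (dyadic_game (- m') k' + dyadic_game m' k')"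
        using less[of "- m'" k'] size_option[OF *(2)] by simp
      then have "normal_win (opponent p) K"
        using normal_winI[OF options_plus_leftI[OF *(2)]] * 2 by simp
      then show False using K by simp
    qed
  qed
qed

lemma dyadic_game_scale: "dyadic_game (m * 2 ^ j) (k + j) = dyadic_game m k"
  by (induction j) (simp_all add: mult.left_commute[of m])

lemma normal_equiv_normal_win: "normal_equiv A B \<Longrightarrow> normal_win p (A + G) \<longleftrightarrow> normal_win p (B + G)"
  by (cases p) (auto simp: normal_equiv_def normal_outcome_def outcome_of_def split: if_splits)

text \<open>Both games are replaced by canonical forms. Written over the common denominator
  \<open>2 ^ (k + l)\<close>, these have opposite numerators, so the mirror strategy
  applies.\<close>

lemma has_value_sum_zero:
  assumes "has_value A x" "has_value B y" "x + y = 0"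
  shows "\<not> normal_win p (A + B)"
proof -
  obtain m k where m: "x = of_int m / 2 ^ k" "normal_equiv A (dyadic_game m k)"
    using assms(1) by (auto simp: has_value_def)
  obtain n l where n: "y = of_int n / 2 ^ l" "normal_equiv B (dyadic_game n l)"
    using assms(2) by (auto simp: has_value_def)
  have "(of_int (n * 2 ^ k) :: rat) = of_int (- (m * 2 ^ l))"
    using assms(3) m(1) n(1) by (simp add: field_simps)
  then have nm: "n * 2 ^ k = - (m * 2 ^ l)" by (simp only: of_int_eq_iff)
  have "normal_win p (A + B) \<longleftrightarrow> normal_win p (dyadic_game n l + dyadic_game m k)"
    using normal_equiv_normal_win[OF m(2)] normal_equiv_normal_win[OF n(2)]
    by (metis plus_game_commute)
  also have "dyadic_game n l = dyadic_game (- (m * 2 ^ l)) (k + l)"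
    using dyadic_game_scale[of n k l] nm by (simp add: add.commute)
  also have "dyadic_game m k = dyadic_game (m * 2 ^ l) (k + l)"
    by (simp add: dyadic_game_scale)
  finally show ?thesis
    using not_normal_win_dyadic_game_uminus plus_game_commute by metis
qed

section \<open>Red--blue Hackenbush\<close>

text \<open>A cut without its pruning. Unpruned deletions commute, so successive cuts can be
  reordered if pruning is postponed to the end.\<close>

definition delete_edge :: "('v, 'e) hackenbush \<Rightarrow> 'e \<Rightarrow> ('v, 'e) hackenbush" where
  "delete_edge X e = X\<lparr>edges := edges X |-| {|e|}\<rparr>"

abbreviation reachable :: "('v, 'e) hackenbush \<Rightarrow> 'v \<Rightarrow> bool" where
  "reachable X \<equiv> (adjacent X)\<^sup>*\<^sup>* (ground X)"

lemma delete_edge_simps [simp]: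
  "ground (delete_edge X e) = ground X" "edges (delete_edge X e) = edges X |-| {|e|}"
  "ends (delete_edge X e) = ends X" "colour (delete_edge X e) = colour X"
  by (simp_all add: delete_edge_def)

lemma prune_simps [simp]:
  "ground (prune X) = ground X" "edges (prune X) = ffilter (supported X) (edges X)"
  "ends (prune X) = ends X" "colour (prune X) = colour X"
  by (simp_all add: prune_def)

lemma delete_edge_commute: "delete_edge (delete_edge X e) f = delete_edge (delete_edge X f) e"
proof -
  have "edges X |-| {|e|} |-| {|f|} = edges X |-| {|f|} |-| {|e|}" by auto
  then show ?thesis by (simp add: delete_edge_def)
qed

lemma delete_edge_absent: "e |\<notin>| edges X \<Longrightarrow> delete_edge X e = X"
  by (simp add: delete_edge_def)

section \<open>Reachability under deletion and pruning\<close>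

lemma reachable_step:
  assumes "reachable X u" "adjacent X u v" shows "reachable X v"
  using assms by (rule rtranclp.rtrancl_into_rtrancl)

lemma reachable_mono:
  assumes "edges X |\<subseteq>| edges Y" "ends X = ends Y" "ground X = ground Y" "reachable X v"
  shows "reachable Y v"
proof -
  have "adjacent X u w \<Longrightarrow> adjacent Y u w" for u w
    using assms by (fastforce simp: adjacent_def)
  then show ?thesis using assms(3,4) mono_rtranclp by metis
qed

lemma supported_if_adjacent:
  assumes "e |\<in>| edges X" "ends X e = (u, v) \<or> ends X e = (v, u)" "reachable X u"
  shows "supported X e"
proof -
  have "reachable X v"
    using assms by (intro reachable_step[OF assms(3)]) (auto simp: adjacent_def)
  then show ?thesis using assms by (auto simp: supported_def)
qed

lemma reachable_delete_edge: "reachable (delete_edge X e) v \<Longrightarrow> reachable X v"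
  by (rule reachable_mono[of "delete_edge X e"]) auto

lemma supported_delete_edge: "supported (delete_edge X e) f \<Longrightarrow> supported X f"
  unfolding supported_def using reachable_delete_edge by fastforce

lemma prune_eqI:
  assumes "edges (prune X) = edges (prune Y)" "\<And>S. X\<lparr>edges := S\<rparr> = Y\<lparr>edges := S\<rparr>"
  shows "prune X = prune Y"
  using assms by (simp add: prune_def)

lemma reachable_prune_delete:
  "reachable (delete_edge (prune X) e) v \<longleftrightarrow> reachable (delete_edge X e) v"
proof
  show "reachable (delete_edge (prune X) e) v \<Longrightarrow> reachable (delete_edge X e) v"
    by (rule reachable_mono[of "delete_edge (prune X) e"]) auto
  assume "reachable (delete_edge X e) v"
  then show "reachable (delete_edge (prune X) e) v"
  proof (induction rule: rtranclp_induct)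
    case (step u w)
    from step(2) obtain f where f: "f |\<in>| edges X" "f \<noteq> e" "ends X f = (u, w) \<or> ends X f = (w, u)"
      by (auto simp: adjacent_def)
    have "reachable X u" using step(1) reachable_delete_edge by fastforce
    then have "supported X f" using f supported_if_adjacent by metis
    then have "adjacent (delete_edge (prune X) e) u w" using f by (auto simp: adjacent_def)
    then show ?case using step.IH rtranclp.rtrancl_into_rtrancl by fastforce
  qed simp
qed

text \<open>Every edge of \<open>X\<close> on a path from the ground is supported, so an earlier
  pruning breaks no path that avoids \<open>e\<close>.\<close>

lemma prune_delete_prune: "prune (delete_edge (prune X) e) = prune (delete_edge X e)"
proof (rule prune_eqI)
  have "supported (delete_edge (prune X) e) f = supported (delete_edge X e) f" for f
    using reachable_prune_delete[of X e] by (simp add: supported_def)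
  then show "edges (prune (delete_edge (prune X) e)) = edges (prune (delete_edge X e))"
    by (auto dest: supported_delete_edge)
qed (simp add: delete_edge_def prune_def)

lemma reachable_prune: "reachable (prune X) v \<longleftrightarrow> reachable X v"
proof
  show "reachable (prune X) v \<Longrightarrow> reachable X v"
    by (rule reachable_mono[of "prune X"]) auto
  assume "reachable X v"
  then show "reachable (prune X) v"
  proof (induction rule: rtranclp_induct)
    case (step u w)
    from step(2) obtain f where f: "f |\<in>| edges X" "ends X f = (u, w) \<or> ends X f = (w, u)"
      by (auto simp: adjacent_def)
    then have "supported X f" using step(1) supported_if_adjacent by metis
    then have "adjacent (prune X) u w" using f by (auto simp: adjacent_def)
    then show ?case using step.IH rtranclp.rtrancl_into_rtrancl by fastforce
  qed simp
qed

lemma prune_prune: "prune (prune X) = prune X"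
proof (rule prune_eqI)
  have "supported (prune X) f = supported X f" for f
    using reachable_prune[of X] by (simp add: supported_def)
  then show "edges (prune (prune X)) = edges (prune X)" by auto
qed (simp add: prune_def)

lemma prune_delete_absent:
  assumes "e |\<notin>| edges (prune X)"
  shows "prune (delete_edge X e) = prune X"
  using prune_delete_prune[of X e] delete_edge_absent[OF assms] prune_prune by metis

text \<open>A path to \<open>e\<close> that needs \<open>b\<close> reaches \<open>b\<close> before \<open>e\<close>.\<close>

lemma supported_exchange:
  assumes e: "e |\<in>| edges (prune X)" "e |\<notin>| edges (prune (delete_edge X b))"
    and b: "b |\<in>| edges X" and ne: "e \<noteq> b"
  shows "b |\<in>| edges (prune (delete_edge X e))"
proof (rule ccontr)
  assume "b |\<notin>| edges (prune (delete_edge X e))"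
  from prune_delete_absent[OF this] prune_delete_absent[OF e(2)]
  \<comment> \<open>If each edge fell with the other, deleting either one would leave the same
    position as deleting both.\<close>
  have eq: "prune (delete_edge X e) = prune (delete_edge X b)"
    using delete_edge_commute by metis
  have R: "reachable (delete_edge X e) v \<longleftrightarrow> reachable (delete_edge X b) v" for v
    using reachable_prune[of "delete_edge X e"] reachable_prune[of "delete_edge X b"] eq by simp
  \<comment> \<open>Each edge of a path survives at least one of the two deletions, and these reach
    the same vertices. So deleting \<open>b\<close> would disconnect nothing, although
    \<open>e\<close> falls with it.\<close>
  have "reachable (delete_edge X b) v" if "reachable X v" for v
    using that
  proof (induction rule: rtranclp_induct)
    case (step u w)
    from step(2) obtain f where f: "f |\<in>| edges X" "ends X f = (u, w) \<or> ends X f = (w, u)"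
      by (auto simp: adjacent_def)
    show ?case
    proof (cases "f = e")
      case True
      then have "adjacent (delete_edge X b) u w" using f ne by (auto simp: adjacent_def)
      then show ?thesis using reachable_step step.IH by metis
    next
      case False
      then have "adjacent (delete_edge X e) u w" using f by (auto simp: adjacent_def)
      then show ?thesis using reachable_step step.IH R by metis
    qed
  qed simp
  then have "supported (delete_edge X b) e" using e(1) by (auto simp: supported_def)
  then show False using e ne by auto
qed

section \<open>Moves and outcomes of pruned graphs\<close>

fun cuttable :: "player \<Rightarrow> colour set" where
  "cuttable Left = {Blue, Green}"
| "cuttable Right = {Red, Green}"

lemma options_hackenbush_prune:
  "options p (hackenbush_game (prune X)) =
    (\<lambda>e. hackenbush_game (prune (delete_edge X e))) |`|
      ffilter (\<lambda>e. colour X e \<in> cuttable p) (edges (prune X))"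
proof -
  have "cut_edge (prune X) e = prune (delete_edge X e)" for e
    using prune_delete_prune[of X e] by (simp add: cut_edge_def delete_edge_def)
  then show ?thesis by (cases p) (simp_all add: hackenbush_game.simps[of "prune X"])
qed

lemma normal_win_hackenbush_prune:
  "normal_win p (hackenbush_game (prune X)) \<longleftrightarrow>
    (\<exists>e. e |\<in>| edges (prune X) \<and> colour X e \<in> cuttable p \<and>
      \<not> normal_win (opponent p) (hackenbush_game (prune (delete_edge X e))))"
  by (subst normal_win.simps) (auto simp: options_hackenbush_prune)

text \<open>
  Left keeps her strategy for the graph without \<open>b\<close>; if Right cuts an edge that is held up only by \<open>b\<close>, she cuts \<open>b\<close>.
\<close>

lemma not_normal_win_Right_restore:
  assumes "red_blue X" "colour X b = Blue"
    and "\<not> normal_win Right (hackenbush_game (prune (delete_edge X b)))"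
  shows "\<not> normal_win Right (hackenbush_game (prune X))"
  using assms
proof (induction "fcard (edges X)" arbitrary: X rule: less_induct)
  case less
  show ?case
  proof (cases "b |\<in>| edges X")
    case False
    then show ?thesis using less.prems delete_edge_absent by metis
  next
    case True
    show ?thesis
    proof
      assume "normal_win Right (hackenbush_game (prune X))"
      then obtain e where e: "e |\<in>| edges (prune X)" "colour X e \<in> cuttable Right"
        "\<not> normal_win Left (hackenbush_game (prune (delete_edge X e)))"
        by (subst (asm) normal_win_hackenbush_prune) auto
      have ne: "e \<noteq> b" using e(2) less.prems by auto
      show False
      proof (cases "e |\<in>| edges (prune (delete_edge X b))")
        \<comment> \<open>Right's cut \<open>e\<close> is also legal without \<open>b\<close>, and
          Left has an answer \<open>f\<close> there. She plays \<open>f\<close> with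
          \<open>b\<close> present; the induction hypothesis restores \<open>b\<close> after both
          cuts.\<close>
        case T: True
        then have "normal_win Left (hackenbush_game (prune (delete_edge (delete_edge X b) e)))"
          using less.prems(3) e(2) by (subst (asm) normal_win_hackenbush_prune) auto
        then obtain f where f: "f |\<in>| edges (prune (delete_edge (delete_edge X b) e))"
          "colour X f \<in> cuttable Left"
          "\<not> normal_win Right
            (hackenbush_game (prune (delete_edge (delete_edge (delete_edge X b) e) f)))"
          by (subst (asm) normal_win_hackenbush_prune) auto
        have swap: "delete_edge (delete_edge (delete_edge X b) e) f
            = delete_edge (delete_edge (delete_edge X e) f) b"
          by (metis delete_edge_commute)
        have "fcard (edges (delete_edge (delete_edge X e) f)) < fcard (edges X)"
          using e(1) by (intro pfsubset_fcard_mono) auto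
        then have "\<not> normal_win Right (hackenbush_game (prune (delete_edge (delete_edge X e) f)))"
          using less.hyps[of "delete_edge (delete_edge X e) f"] less.prems f(3) swap
          by (simp add: red_blue_def)
        moreover have "f |\<in>| edges (prune (delete_edge X e))"
          using f(1) delete_edge_commute[of X b e] supported_delete_edge by auto
        ultimately have "normal_win Left (hackenbush_game (prune (delete_edge X e)))"
          using f(2) by (subst normal_win_hackenbush_prune) auto
        then show False using e(3) by simp
      next
        \<comment> \<open>Here \<open>e\<close> is held up only by \<open>b\<close>, while
          \<open>b\<close> still stands after \<open>e\<close> is cut. Cutting \<open>b\<close> then
          leads to the position of the assumption, since \<open>e\<close> would have fallen with
          \<open>b\<close> anyway.\<close>
        case F: False
        have "b |\<in>| edges (prune (delete_edge X e))"
          using supported_exchange[OF e(1) F True ne] .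
        moreover have "prune (delete_edge (delete_edge X e) b) = prune (delete_edge X b)"
          using prune_delete_absent[OF F] delete_edge_commute by metis
        ultimately have "normal_win Left (hackenbush_game (prune (delete_edge X e)))"
          using less.prems by (subst normal_win_hackenbush_prune) auto
        then show False using e(3) by simp
      qed
    qed
  qed
qed

text \<open>A winning first cut by Left removes a blue edge. Restoring that edge does not help
  Right, so Right already loses moving first in the original graph.\<close>

lemma never_fuzzy_hackenbush_prune:
  "red_blue X \<Longrightarrow> never_fuzzy (hackenbush_game (prune X))"
proof (induction "fcard (edges X)" arbitrary: X rule: less_induct)
  case less
  show ?case
  proof (rule never_fuzzy.intros)
    show "\<not> (normal_win Left (hackenbush_game (prune X)) \<and>
        normal_win Right (hackenbush_game (prune X)))"
    proof
      assume a: "normal_win Left (hackenbush_game (prune X)) \<and>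
        normal_win Right (hackenbush_game (prune X))"
      then obtain b where b: "b |\<in>| edges (prune X)" "colour X b \<in> cuttable Left"
        "\<not> normal_win Right (hackenbush_game (prune (delete_edge X b)))"
        using normal_win_hackenbush_prune[of Left X] by auto
      then have "colour X b = Blue" using less.prems by (auto simp: red_blue_def)
      then show False
        using not_normal_win_Right_restore[OF less.prems _ b(3)] a by simp
    qed
    fix p G'
    assume "G' |\<in>| options p (hackenbush_game (prune X))"
    then obtain e where e: "e |\<in>| edges X" "G' = hackenbush_game (prune (delete_edge X e))"
      by (auto simp: options_hackenbush_prune)
    have "fcard (edges (delete_edge X e)) < fcard (edges X)"
      using e(1) by (intro pfsubset_fcard_mono) auto
    then show "never_fuzzy G'" using less e by (auto simp: red_blue_def)
  qed
qed

lemma never_fuzzy_hackenbush: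
  assumes "position X" "red_blue X"
  shows "never_fuzzy (hackenbush_game X)"
proof -
  have "ffilter (supported X) (edges X) = edges X"
    using assms(1) by (auto simp: position_def)
  then have "prune X = X" by (simp add: prune_def)
  then show ?thesis using never_fuzzy_hackenbush_prune[OF assms(2)] by simp
qed

theorem theorem4p2:
  fixes X :: "('v, 'e) hackenbush" and Y :: "('w, 'f) hackenbush" and x y :: rat
  assumes "position X" and "red_blue X"
    and "position Y" and "red_blue Y"
    and "has_value (hackenbush_game X) x"
    and "has_value (hackenbush_game Y) y"
    and "x + y = 0"
  shows "misere_equiv_mod dicots
           (ordinal_sum star (hackenbush_game X) + ordinal_sum star (hackenbush_game Y)) 0"
proof -
  let ?S = "ordinal_sum star (hackenbush_game X) + ordinal_sum star (hackenbush_game Y)"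
  have "misere_win p (?S + G) \<longleftrightarrow> misere_win p G" if "dicot G" for p G
  proof -
    note S = sprigs_plus_dicot[OF that never_fuzzy_hackenbush[OF assms(1,2)]
        never_fuzzy_hackenbush[OF assms(3,4)] has_value_sum_zero[OF assms(5-7)]]
    \<comment> \<open>The first-mover claim for \<open>p\<close> gives one implication, the
      second-mover claim for \<open>opponent p\<close> the other.\<close>
    from S[of p] S[of "opponent p"] show ?thesis by auto
  qed
  then show ?thesis
    by (simp add: misere_equiv_mod_def dicots_def misere_outcome_def outcome_of_def
        zero_plus_game)
qed

end
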